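(* Let $D\subset\mathbb{R}^2$ be a polygonal domain, let $\sigma>0$ be a constant, and let $A_1,A_2,R\in\mathbb{R}^{n\times n}$ be constant real symmetric matrices with $R$ non negative, i.e. $(R\mathbf{x},\mathbf{x})\ge 0$ for all $\mathbf{x}\in\mathbb{R}^n$, and $\operatorname{Ker}R\neq\{\mathbf{0}\}$. Let $(\mathbf{E}_1,\dots,\mathbf{E}_n)$ be an orthonormal basis of $\mathbb{R}^n$ consisting of eigenvectors of $R$, such that $(\mathbf{E}_1,\dots,\mathbf{E}_p)$ is a basis of $\operatorname{Ker}R$. Assume that there are two linearly independent vectors $\mathbf{E}_{i_1},\mathbf{E}_{i_2}$ of this basis, associated to eigenvalues $\lambda_{i_1}>0$ and $\lambda_{i_2}>0$ of $R$, and real numbers $\gamma^1_i,\gamma^2_i$ ($1\le i\le p$), such that $$A_1\mathbf{E}_i=\gamma^1_i\,\mathbf{E}_{i_1},\qquad A_2\mathbf{E}_i=\gamma^2_i\,\mathbf{E}_{i_2}\qquad\text{for all } i\in\{1,\dots,p\}.$$ Then the system $$\partial_t\mathbf{U}+\frac{1}{\varepsilon}A_1\partial_x\mathbf{U}+\frac{1}{\varepsilon}A_2\partial_y\mathbf{U}=-\frac{\sigma}{\varepsilon^2}R\mathbf{U},\qquad \mathbf{U}:D\times\mathbb{R}^+\to\mathbb{R}^n,\quad \varepsilon\in\,]0,1],$$ admits the formal diffusion limit (in the sense given in the context) $$\partial_t\mathbf{V}-\frac{1}{\lambda_{i_1}\sigma}K_1\,\partial_{xx}\mathbf{V}-\frac{1}{\lambda_{i_2}\sigma}K_2\,\partial_{yy}\mathbf{V}=\mathbf{0},$$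 with $\mathbf{V}=((\mathbf{U},\mathbf{E}_1),\dots,(\mathbf{U},\mathbf{E}_p))\in\mathbb{R}^p$ (where $\mathbf{U}$ stands for its leading-order term $\mathbf{U}_0$), and where $K_1=\gamma^1\otimes\gamma^1\in\mathbb{R}^{p\times p}$ and $K_2=\gamma^2\otimes\gamma^2\in\mathbb{R}^{p\times p}$, with $\gamma^k=(\gamma^k_1,\dots,\gamma^k_p)$, are non negative symmetric matrices.
   Context: $(\cdot,\cdot)$ denotes the Euclidean scalar product; $(\mathbf{a}\otimes\mathbf{b})_{ij}=a_ib_j$; a symmetric matrix $K$ is non negative if $(\mathbf{X},K\mathbf{X})\ge 0$ for all $\mathbf{X}$. Formal diffusion limit (via Hilbert expansion): one inserts $\mathbf{U}=\mathbf{U}_0+\varepsilon\mathbf{U}_1+\varepsilon^2\mathbf{U}_2+o(\varepsilon^2)$ into the system and equates the coefficients of $\varepsilon^{-2},\varepsilon^{-1},\varepsilon^{0}$, which gives the hierarchy $$R\mathbf{U}_0=\mathbf{0},\qquad A_1\partial_x\mathbf{U}_0+A_2\partial_y\mathbf{U}_0=-\sigma R\mathbf{U}_1,\qquad \partial_t\mathbf{U}_0+A_1\partial_x\mathbf{U}_1+A_2\partial_y\mathbf{U}_1=-\sigma R\mathbf{U}_2 .$$ To say that the system admits a given equation for $\mathbf{V}$ as formal diffusion limit means that, whenever smooth functions $\mathbf{U}_0,\mathbf{U}_1,\mathbf{U}_2:D\times\mathbb{R}^+\to\mathbb{R}^n$ (independent of $\varepsilon$) satisfy this hierarchy, the function $\mathbf{V}=((\mathbf{U}_0,\mathbf{E}_1),\dots,(\mathbf{U}_0,\mathbf{E}_p))$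 satisfies that equation. *)

theory Defs
  imports "HOL-Analysis.Analysis"
begin

text \<open>
  Fields are functions of \<open>(x, y, t)\<close> with \<open>(x, y) \<in> D\<close> and \<open>t \<ge> 0\<close>.  At \<open>t = 0\<close> time
  derivatives are one-sided; the set \<open>D\<close> is open, so space derivatives never are.
\<close>

definition polygonal_domain :: "(real \<times> real) set \<Rightarrow> bool" where
  "polygonal_domain D \<longleftrightarrow>
     D \<noteq> {} \<and> open D \<and> connected D \<and> bounded D \<and>
     (\<exists>S. finite S \<and> frontier D = (\<Union>(a, b)\<in>S. closed_segment a b))"

definition space_time :: "(real \<times> real) set \<Rightarrow> (real \<times> real \<times> real) set" where
  "space_time D = {(x, y, t). (x, y) \<in> D \<and> 0 \<le> t}"

definition dx :: "(real \<times> real \<times> real \<Rightarrow> 'a::real_normed_vector) \<Rightarrow> real \<times> real \<times> real \<Rightarrow> 'a" where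
  "dx f = (\<lambda>(x, y, t). vector_derivative (\<lambda>s. f (s, y, t)) (at x))"

definition dy :: "(real \<times> real \<times> real \<Rightarrow> 'a::real_normed_vector) \<Rightarrow> real \<times> real \<times> real \<Rightarrow> 'a" where
  "dy f = (\<lambda>(x, y, t). vector_derivative (\<lambda>s. f (x, s, t)) (at y))"

definition dt :: "(real \<times> real \<times> real \<Rightarrow> 'a::real_normed_vector) \<Rightarrow> real \<times> real \<times> real \<Rightarrow> 'a" where
  "dt f = (\<lambda>(x, y, t). vector_derivative (\<lambda>s. f (x, y, s)) (at t within {0..}))"

text \<open>
  \<open>Ck_on k S f\<close>: all iterated directional derivatives of \<open>f\<close> up to order \<open>k\<close> exist (as Frechet
  derivatives within \<open>S\<close>) and are continuous on \<open>S\<close>.  Derivatives within \<open>S\<close> are unique for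
  \<open>S = space_time D\<close> with \<open>D\<close> open, so \<open>smooth_on\<close> means smoothness up to and including \<open>t = 0\<close>.
\<close>

primrec Ck_on :: "nat \<Rightarrow> 'a::real_normed_vector set \<Rightarrow> ('a \<Rightarrow> 'b::real_normed_vector) \<Rightarrow> bool" where
  "Ck_on 0 S f \<longleftrightarrow> continuous_on S f"
| "Ck_on (Suc k) S f \<longleftrightarrow>
     f differentiable_on S \<and> (\<forall>v. Ck_on k S (\<lambda>z. frechet_derivative f (at z within S) v))"

definition smooth_on :: "'a::real_normed_vector set \<Rightarrow> ('a \<Rightarrow> 'b::real_normed_vector) \<Rightarrow> bool" where
  "smooth_on S f \<longleftrightarrow> (\<forall>k. Ck_on k S f)"

definition symmetric_matrix :: "real^'m^'m \<Rightarrow> bool" where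
  "symmetric_matrix K \<longleftrightarrow> transpose K = K"

definition nonneg_matrix :: "real^'m^'m \<Rightarrow> bool" where
  "nonneg_matrix K \<longleftrightarrow> (\<forall>X. 0 \<le> X \<bullet> (K *v X))"

definition tensor :: "real^'m \<Rightarrow> real^'m \<Rightarrow> real^'m^'m" where
  "tensor a b = (\<chi> i j. a $ i * b $ j)"

definition matrix_kernel :: "real^'n^'n \<Rightarrow> (real^'n) set" where
  "matrix_kernel R = {x. R *v x = 0}"

text \<open>
  Inserting \<open>U = U0 + \<epsilon> U1 + \<epsilon>\<^sup>2 U2 + o(\<epsilon>\<^sup>2)\<close> into the system
  \<open>\<partial>\<^sub>t U + (1/\<epsilon>) A1 \<partial>\<^sub>x U + (1/\<epsilon>) A2 \<partial>\<^sub>y U = - (\<sigma>/\<epsilon>\<^sup>2) R U\<close>, \<open>0 < \<epsilon> \<le> 1\<close>,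
  and equating the coefficients of \<open>1/\<epsilon>\<^sup>2\<close>, \<open>1/\<epsilon>\<close> and \<open>1\<close> (the first one divided by \<open>-\<sigma>\<close>)
  gives the three equations below.
\<close>

definition hilbert_hierarchy ::
  "(real \<times> real) set \<Rightarrow> real \<Rightarrow> real^'n^'n \<Rightarrow> real^'n^'n \<Rightarrow> real^'n^'n \<Rightarrow>
   (real \<times> real \<times> real \<Rightarrow> real^'n) \<Rightarrow> (real \<times> real \<times> real \<Rightarrow> real^'n) \<Rightarrow>
   (real \<times> real \<times> real \<Rightarrow> real^'n) \<Rightarrow> bool" where
  "hilbert_hierarchy D \<sigma> A1 A2 R U0 U1 U2 \<longleftrightarrow>
     (\<forall>z\<in>space_time D.
        R *v U0 z = 0 \<and>
        A1 *v dx U0 z + A2 *v dy U0 z = - (\<sigma> *\<^sub>R (R *v U1 z)) \<and>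
        dt U0 z + A1 *v dx U1 z + A2 *v dy U1 z = - (\<sigma> *\<^sub>R (R *v U2 z)))"

text \<open>
  The system with data \<open>(D, \<sigma>, A1, A2, R)\<close> admits the equation \<open>\<Phi>\<close> as formal diffusion limit,
  the unknown \<open>V\<close> collecting the components of \<open>U0\<close> along the vectors \<open>F\<close>.
\<close>

definition admits_formal_diffusion_limit ::
  "(real \<times> real) set \<Rightarrow> real \<Rightarrow> real^'n^'n \<Rightarrow> real^'n^'n \<Rightarrow> real^'n^'n \<Rightarrow> ('p \<Rightarrow> real^'n) \<Rightarrow>
   ((real \<times> real \<times> real \<Rightarrow> real^'p) \<Rightarrow> bool) \<Rightarrow> bool" where
  "admits_formal_diffusion_limit D \<sigma> A1 A2 R F \<Phi> \<longleftrightarrow>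
     (\<forall>U0 U1 U2.
        smooth_on (space_time D) U0 \<longrightarrow> smooth_on (space_time D) U1 \<longrightarrow>
        smooth_on (space_time D) U2 \<longrightarrow> hilbert_hierarchy D \<sigma> A1 A2 R U0 U1 U2 \<longrightarrow>
        \<Phi> (\<lambda>z. \<chi> i. U0 z \<bullet> F i))"

definition diffusion_equation ::
  "(real \<times> real) set \<Rightarrow> real \<Rightarrow> real^'p^'p \<Rightarrow> real \<Rightarrow> real^'p^'p \<Rightarrow>
   (real \<times> real \<times> real \<Rightarrow> real^'p) \<Rightarrow> bool" where
  "diffusion_equation D c1 K1 c2 K2 V \<longleftrightarrow>
     (\<forall>z\<in>space_time D.
        dt V z - c1 *\<^sub>R (K1 *v dx (dx V) z) - c2 *\<^sub>R (K2 *v dy (dy V) z) = 0)"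

text \<open>
  \<open>\<iota>\<close> enumerates the part \<open>E\<^sub>1, \<dots>, E\<^sub>p\<close> of the basis that spans \<open>Ker R\<close>: the ordered index
  sets \<open>{1..n}\<close> and \<open>{1..p}\<close> are replaced by finite types \<open>'n\<close> and \<open>'p\<close>, and the inclusion
  of the second in the first by an injection.
\<close>

definition eigenbasis_with_kernel_part ::
  "real^'n^'n \<Rightarrow> ('n \<Rightarrow> real^'n) \<Rightarrow> ('n \<Rightarrow> real) \<Rightarrow> ('p::finite \<Rightarrow> 'n) \<Rightarrow> bool" where
  "eigenbasis_with_kernel_part R E \<mu> \<iota> \<longleftrightarrow>
     (\<forall>i j. E i \<bullet> E j = (if i = j then 1 else 0)) \<and> span (range E) = UNIV \<and>
     (\<forall>i. R *v E i = \<mu> i *\<^sub>R E i) \<and>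
     inj \<iota> \<and> independent (range (\<lambda>i. E (\<iota> i))) \<and> span (range (\<lambda>i. E (\<iota> i))) = matrix_kernel R"

end

theory Submission
  imports Defs
begin

text \<open>
  Write \<open>P u\<close> for the vector of the components of \<open>u\<close> along the basis \<open>E (\<iota> i)\<close> of \<open>Ker R\<close>, so that
  \<open>V = P U0\<close>.  The limit equation is \<open>P\<close> applied to the last equation of the hierarchy, and the
  unknown \<open>U1\<close> in it is eliminated by the equation before it.

  The symmetric matrix \<open>R\<close> vanishes on its kernel, so \<open>P\<close> annihilates \<open>R U2\<close>.
  By symmetry of \<open>A1\<close> and \<open>A1 E\<^sub>i = \<gamma>1\<^sub>i E\<^bsub>i1\<^esub>\<close>, the vector \<open>P (A1 w)\<close> is \<open>(w \<bullet> E\<^bsub>i1\<^esub>) \<gamma>1\<close>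
  (\<open>kernel_coords_flux\<close>), so only the two scalars \<open>\<partial>\<^sub>x U1 \<bullet> E\<^bsub>i1\<^esub>\<close> and \<open>\<partial>\<^sub>y U1 \<bullet> E\<^bsub>i2\<^esub>\<close> are left:
  \<open>\<partial>\<^sub>t V + (\<partial>\<^sub>x U1 \<bullet> E\<^bsub>i1\<^esub>) \<gamma>1 + (\<partial>\<^sub>y U1 \<bullet> E\<^bsub>i2\<^esub>) \<gamma>2 = 0\<close>.
  Since \<open>U0\<close> stays in the subspace \<open>Ker R\<close>, so do its derivatives, and there \<open>A1\<close> is
  \<open>w \<mapsto> (\<gamma>1 \<bullet> P w) E\<^bsub>i1\<^esub>\<close>.  The two terms of the middle equation of the hierarchy are thus
  multiples of the orthogonal vectors \<open>E\<^bsub>i1\<^esub>\<close> and \<open>E\<^bsub>i2\<^esub>\<close>, and taking the component along one of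
  them isolates one direction (\<open>corrector_component\<close>):
  \<open>- \<sigma> \<mu>\<^bsub>i1\<^esub> (U1 \<bullet> E\<^bsub>i1\<^esub>) = \<gamma>1 \<bullet> \<partial>\<^sub>x V\<close>.
  Differentiating this in \<open>x\<close>, and likewise for \<open>y\<close>, gives
  the two scalars in terms of second derivatives of \<open>V\<close> (\<open>corrector_derivative\<close>), and
  \<open>(\<gamma>1 \<bullet> X) \<gamma>1 = (\<gamma>1 \<otimes> \<gamma>1) X\<close> turns the result into the diffusion equation.
\<close>

section \<open>Partial derivatives on the space-time domain\<close>

text \<open>
  The operators \<open>dx\<close>, \<open>dy\<close>, \<open>dt\<close> differentiate along lines, while smoothness is stated with
  Frechet derivatives within \<open>S\<close>.  This property is the only link between the two that is used; it
  also makes \<open>d f\<close> on \<open>S\<close> depend on the values of \<open>f\<close> on \<open>S\<close> only, for differentiable \<open>f\<close>.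
\<close>

definition derivative_along ::
  "'a::real_normed_vector set \<Rightarrow> 'a \<Rightarrow> (('a \<Rightarrow> 'b::real_normed_vector) \<Rightarrow> 'a \<Rightarrow> 'b) \<Rightarrow> bool" where
  "derivative_along S v d \<longleftrightarrow>
     (\<forall>f f' z. z \<in> S \<longrightarrow> (f has_derivative f') (at z within S) \<longrightarrow> d f z = f' v)"

lemma derivative_alongD:
  "derivative_along S v d \<Longrightarrow> z \<in> S \<Longrightarrow> (f has_derivative f') (at z within S) \<Longrightarrow> d f z = f' v"
  unfolding derivative_along_def by blast

lemma has_vector_derivative_along_curve:
  assumes "(f has_derivative f') (at (c s) within S)"
    and "(c has_vector_derivative v) (at s within T)" and "c ` T \<subseteq> S"
  shows "((\<lambda>s. f (c s)) has_vector_derivative f' v) (at s within T)"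
proof -
  interpret f': bounded_linear f'
    using assms(1) by (rule has_derivative_bounded_linear)
  have "((\<lambda>s. f (c s)) has_derivative (\<lambda>h. f' (h *\<^sub>R v))) (at s within T)"
    by (rule has_derivative_in_compose[OF assms(2)[unfolded has_vector_derivative_def]
          has_derivative_subset[OF assms(1) assms(3)]])
  then show ?thesis
    by (simp add: has_vector_derivative_def f'.scaleR)
qed

lemma derivative_along_dx:
  assumes "open D"
  shows "derivative_along (space_time D) (1, 0, 0) dx"
  unfolding derivative_along_def
proof (intro allI impI)
  fix f :: "real \<times> real \<times> real \<Rightarrow> 'a" and f' z
  assume z: "z \<in> space_time D" and f': "(f has_derivative f') (at z within space_time D)"
  obtain x y t where [simp]: "z = (x, y, t)" by (cases z) auto
  have xy: "(x, y) \<in> D" and t: "0 \<le> t"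
    using z by (auto simp: space_time_def)
  \<comment> \<open>The part of the line inside the domain is open, so the derivative within it is two-sided;
    this also holds on the boundary \<open>t = 0\<close>.\<close>
  let ?T = "(\<lambda>s. (s, y)) -` D"
  have T: "open ?T"
    by (intro open_vimage assms continuous_intros)
  have curve: "((\<lambda>s. (s, y, t)) has_vector_derivative (1, 0, 0)) (at x within ?T)"
    by (intro has_vector_derivative_Pair has_vector_derivative_const has_vector_derivative_id)
  have "((\<lambda>s. f (s, y, t)) has_vector_derivative f' (1, 0, 0)) (at x within ?T)"
    by (rule has_vector_derivative_along_curve[OF _ curve, where S = "space_time D"])
      (use f' t in \<open>auto simp: space_time_def\<close>)
  then have "((\<lambda>s. f (s, y, t)) has_vector_derivative f' (1, 0, 0)) (at x)"
    using at_within_open[OF _ T] xy by simp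
  then show "dx f z = f' (1, 0, 0)"
    by (simp add: dx_def vector_derivative_at)
qed

lemma derivative_along_dy:
  assumes "open D"
  shows "derivative_along (space_time D) (0, 1, 0) dy"
  unfolding derivative_along_def
proof (intro allI impI)
  fix f :: "real \<times> real \<times> real \<Rightarrow> 'a" and f' z
  assume z: "z \<in> space_time D" and f': "(f has_derivative f') (at z within space_time D)"
  obtain x y t where [simp]: "z = (x, y, t)" by (cases z) auto
  have xy: "(x, y) \<in> D" and t: "0 \<le> t"
    using z by (auto simp: space_time_def)
  let ?T = "(\<lambda>s. (x, s)) -` D"
  have T: "open ?T"
    by (intro open_vimage assms continuous_intros)
  have curve: "((\<lambda>s. (x, s, t)) has_vector_derivative (0, 1, 0)) (at y within ?T)"
    by (intro has_vector_derivative_Pair has_vector_derivative_const has_vector_derivative_id)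
  have "((\<lambda>s. f (x, s, t)) has_vector_derivative f' (0, 1, 0)) (at y within ?T)"
    by (rule has_vector_derivative_along_curve[OF _ curve, where S = "space_time D"])
      (use f' t in \<open>auto simp: space_time_def\<close>)
  then have "((\<lambda>s. f (x, s, t)) has_vector_derivative f' (0, 1, 0)) (at y)"
    using at_within_open[OF _ T] xy by simp
  then show "dy f z = f' (0, 1, 0)"
    by (simp add: dy_def vector_derivative_at)
qed

lemma derivative_along_dt:
  "derivative_along (space_time D) (0, 0, 1) dt"
  unfolding derivative_along_def
proof (intro allI impI)
  fix f :: "real \<times> real \<times> real \<Rightarrow> 'a" and f' z
  assume z: "z \<in> space_time D" and f': "(f has_derivative f') (at z within space_time D)"
  obtain x y t where [simp]: "z = (x, y, t)" by (cases z) auto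
  have xy: "(x, y) \<in> D" and t: "0 \<le> t"
    using z by (auto simp: space_time_def)
  have curve: "((\<lambda>s. (x, y, s)) has_vector_derivative (0, 0, 1)) (at t within {0..})"
    by (intro has_vector_derivative_Pair has_vector_derivative_const has_vector_derivative_id)
  have "((\<lambda>s. f (x, y, s)) has_vector_derivative f' (0, 0, 1)) (at t within {0..})"
    by (rule has_vector_derivative_along_curve[OF _ curve, where S = "space_time D"])
      (use f' xy in \<open>auto simp: space_time_def\<close>)
  \<comment> \<open>At \<open>t = 0\<close> the derivative is one-sided, and it is unique as \<open>t\<close> is no isolated point of \<open>{0..}\<close>.\<close>
  moreover have "at t within {0..} \<noteq> bot"
  proof -
    have "at t within {t..t + 1} \<noteq> bot"
      by (simp add: trivial_limit_within islimpt_Icc)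
    moreover have "at t within {t..t + 1} \<le> at t within {0..}"
      using t by (intro at_le) auto
    ultimately show ?thesis
      by (metis bot.extremum_uniqueI)
  qed
  ultimately show "dt f z = f' (0, 0, 1)"
    by (simp add: dt_def vector_derivative_within)
qed

text \<open>
  The Frechet derivative within \<open>S\<close> sees only the values on \<open>S\<close>, so \<open>f\<close> inherits that of \<open>g\<close>.
  The hierarchy gives equalities of fields on \<open>S\<close>, and this allows differentiating them.
\<close>

lemma derivative_along_cong:
  assumes "derivative_along S v d" and "\<And>z. z \<in> S \<Longrightarrow> f z = g z" and "g differentiable_on S"
    and "z \<in> S"
  shows "d f z = d g z"
proof -
  obtain g' where g': "(g has_derivative g') (at z within S)"
    using assms(3,4) by (auto simp: differentiable_on_def differentiable_def)
  have "(f has_derivative g') (at z within S)"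
    by (rule has_derivative_transform[OF assms(4) _ g']) (simp add: assms(2))
  with g' show ?thesis
    using assms(1,4) by (simp add: derivative_alongD)
qed

lemma derivative_along_linear_image:
  assumes "derivative_along S v d" and "derivative_along S v e"
    and "bounded_linear L" and "f differentiable_on S" and "z \<in> S"
  shows "e (\<lambda>z. L (f z)) z = L (d f z)"
proof -
  obtain f' where f': "(f has_derivative f') (at z within S)"
    using assms(4,5) by (auto simp: differentiable_on_def differentiable_def)
  then have "((\<lambda>z. L (f z)) has_derivative (\<lambda>h. L (f' h))) (at z within S)"
    by (rule bounded_linear.has_derivative[OF assms(3)])
  with f' show ?thesis
    using assms(1,2,5) by (simp add: derivative_alongD)
qed

lemma differentiable_on_linear_image:
  assumes "bounded_linear L" and "f differentiable_on S"
  shows "(\<lambda>z. L (f z)) differentiable_on S"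
  using assms(2) unfolding differentiable_on_def differentiable_def
  by (blast intro: bounded_linear.has_derivative[OF assms(1)])

lemma smooth_on_imp_differentiable_on:
  "smooth_on S f \<Longrightarrow> f differentiable_on S"
  unfolding smooth_on_def by (metis Ck_on.simps(2))

lemma smooth_on_imp_derivative_differentiable_on:
  assumes "derivative_along S v d" and "smooth_on S f"
  shows "d f differentiable_on S"
proof -
  let ?g = "\<lambda>z. frechet_derivative f (at z within S) v"
  have "Ck_on (Suc (Suc 0)) S f"
    using assms(2) unfolding smooth_on_def by blast
  then have f: "f differentiable_on S" and g: "?g differentiable_on S"
    by auto
  have "d f z = ?g z" if "z \<in> S" for z
    using assms(1) that f
    by (auto simp: differentiable_on_def frechet_derivative_works intro: derivative_alongD)
  with g show ?thesis
    unfolding differentiable_on_def differentiable_def by (metis has_derivative_transform)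
qed

lemma second_derivative_along_linear_image:
  assumes d: "derivative_along S v d" and e: "derivative_along S v e"
    and L: "bounded_linear L" and f: "smooth_on S f" and z: "z \<in> S"
  shows "e (e (\<lambda>z. L (f z))) z = L (d (d f) z)"
proof -
  have df: "d f differentiable_on S"
    by (rule smooth_on_imp_derivative_differentiable_on[OF d f])
  have "e (e (\<lambda>z. L (f z))) z = e (\<lambda>z. L (d f z)) z"
    by (rule derivative_along_cong[OF e
          derivative_along_linear_image[OF d e L smooth_on_imp_differentiable_on[OF f]]
          differentiable_on_linear_image[OF L df] z])
  also have "\<dots> = L (d (d f) z)"
    by (rule derivative_along_linear_image[OF d e L df z])
  finally show ?thesis .
qed

text \<open>Differentiating \<open>R f = 0\<close> shows that a field with values in \<open>Ker R\<close> has its derivatives there.\<close>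

lemma derivative_along_in_matrix_kernel:
  fixes R :: "real^'n^'n"
  assumes "derivative_along S v d" and "f differentiable_on S"
    and "\<And>z. z \<in> S \<Longrightarrow> R *v f z = 0" and "z \<in> S"
  shows "R *v d f z = 0"
proof -
  obtain f' where f': "(f has_derivative f') (at z within S)"
    using assms(2,4) by (auto simp: differentiable_on_def differentiable_def)
  have "d (\<lambda>z. R *v f z) z = R *v d f z"
    by (rule derivative_along_linear_image[OF assms(1,1) matrix_vector_mul_bounded_linear assms(2,4)])
  moreover have "d (\<lambda>z. R *v f z) z = d (\<lambda>z. 0) z"
    by (rule derivative_along_cong[OF assms(1,3) _ assms(4)]) auto
  moreover have "d (\<lambda>z. 0) z = 0"
    using derivative_alongD[OF assms(1,4) has_derivative_const] by simp
  ultimately show ?thesis by simp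
qed

section \<open>Components along the kernel\<close>

lemma symmetric_matrix_inner:
  "symmetric_matrix A \<Longrightarrow> (A *v x) \<bullet> y = x \<bullet> (A *v y)"
  by (metis dot_lmul_matrix symmetric_matrix_def transpose_matrix_vector)

lemma tensor_mult_vector: "tensor a b *v x = (b \<bullet> x) *\<^sub>R a"
  by (simp add: vec_eq_iff matrix_vector_mult_def tensor_def inner_vec_def sum_distrib_left
      mult.assoc mult.commute mult.left_commute)

lemma symmetric_tensor: "symmetric_matrix (tensor a a)"
  by (simp add: symmetric_matrix_def tensor_def transpose_def vec_eq_iff mult.commute)

lemma nonneg_tensor: "nonneg_matrix (tensor a a)"
  by (simp add: nonneg_matrix_def tensor_mult_vector inner_commute[of a])

definition coords :: "('p::finite \<Rightarrow> real^'n) \<Rightarrow> real^'n \<Rightarrow> real^'p" where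
  "coords F u = (\<chi> i. u \<bullet> F i)"

lemma bounded_linear_coords: "bounded_linear (coords F)"
  by (rule linear_conv_bounded_linear[THEN iffD1])
    (auto intro!: linearI simp: coords_def vec_eq_iff inner_add_left)

text \<open>
  The hypothesis on \<open>A\<close> concerns its action on the kernel alone; symmetry moves \<open>A\<close> onto the basis
  vectors of the kernel, so \<open>w\<close> may be arbitrary.  It is applied to the derivatives of \<open>U1\<close>, which
  need not lie in the kernel.
\<close>

lemma kernel_coords_flux:
  assumes "symmetric_matrix A" and "\<And>i. A *v F i = (\<gamma> $ i) *\<^sub>R e"
  shows "coords F (A *v w) = (w \<bullet> e) *\<^sub>R \<gamma>"
  by (simp add: coords_def vec_eq_iff symmetric_matrix_inner assms mult.commute)

text \<open>The basis of the kernel is orthonormal, so \<open>coords\<close> gives the coefficients in it.\<close>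

lemma kernel_expansion:
  assumes "eigenbasis_with_kernel_part R E \<mu> \<iota>" and "R *v w = 0"
  shows "w = (\<Sum>j\<in>UNIV. coords (\<lambda>i. E (\<iota> i)) w $ j *\<^sub>R E (\<iota> j))"
proof -
  let ?F = "\<lambda>i. E (\<iota> i)"
  have orth: "E i \<bullet> E j = (if i = j then 1 else 0)" for i j
    using assms(1) by (simp add: eigenbasis_with_kernel_part_def)
  have "inj ?F"
    using assms(1) orth unfolding eigenbasis_with_kernel_part_def inj_def by (metis zero_neq_one)
  moreover have "(\<Sum>b\<in>range ?F. (w \<bullet> b) *\<^sub>R b) = w"
  proof (rule orthonormal_basis_expand)
    show "pairwise orthogonal (range ?F)"
      by (auto simp: pairwise_def orthogonal_def orth)
    show "norm b = 1" if "b \<in> range ?F" for b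
      using that by (auto simp: norm_eq_1 orth)
    show "w \<in> span (range ?F)"
      using assms by (simp add: eigenbasis_with_kernel_part_def matrix_kernel_def)
  qed simp
  ultimately show ?thesis
    by (simp add: coords_def sum.reindex)
qed

lemma matrix_on_kernel:
  assumes "eigenbasis_with_kernel_part R E \<mu> \<iota>" and "R *v w = 0"
    and "\<And>i. A *v E (\<iota> i) = (\<gamma> $ i) *\<^sub>R e"
  shows "A *v w = (\<gamma> \<bullet> coords (\<lambda>i. E (\<iota> i)) w) *\<^sub>R e"
proof -
  let ?c = "coords (\<lambda>i. E (\<iota> i)) w"
  have "A *v w = A *v (\<Sum>j\<in>UNIV. ?c $ j *\<^sub>R E (\<iota> j))"
    using kernel_expansion[OF assms(1,2)] by simp
  also have "\<dots> = (\<Sum>j\<in>UNIV. (\<gamma> $ j * ?c $ j) *\<^sub>R e)"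
    by (simp add: linear_sum[OF matrix_vector_mul_linear] matrix_vector_mult_scaleR
        assms(3) mult.commute)
  finally show ?thesis
    by (simp add: inner_vec_def scaleR_sum_left)
qed

section \<open>The first-order corrector\<close>

text \<open>
  By \<open>matrix_on_kernel\<close> the left-hand side is a combination of the orthogonal vectors \<open>E i1\<close> and
  \<open>E i2\<close>; its component along \<open>E i1\<close> does not see \<open>A2\<close>.  The statement for \<open>i2\<close> is the same one
  with the two directions exchanged.
\<close>

lemma corrector_component:
  assumes basis: "eigenbasis_with_kernel_part R E \<mu> \<iota>" and "symmetric_matrix R" and "i1 \<noteq> i2"
    and "\<And>i. A1 *v E (\<iota> i) = (\<gamma>1 $ i) *\<^sub>R E i1"
    and "\<And>i. A2 *v E (\<iota> i) = (\<gamma>2 $ i) *\<^sub>R E i2"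
    and "R *v w1 = 0" and "R *v w2 = 0"
    and eq: "A1 *v w1 + A2 *v w2 = - (\<sigma> *\<^sub>R (R *v u))"
  shows "(- (\<sigma> * \<mu> i1)) * (u \<bullet> E i1) = \<gamma>1 \<bullet> coords (\<lambda>i. E (\<iota> i)) w1"
proof -
  have orth: "E i \<bullet> E j = (if i = j then 1 else 0)" and eig: "R *v E i = \<mu> i *\<^sub>R E i" for i j
    using basis by (simp_all add: eigenbasis_with_kernel_part_def)
  have "(A1 *v w1 + A2 *v w2) \<bullet> E i1 = \<gamma>1 \<bullet> coords (\<lambda>i. E (\<iota> i)) w1"
    using assms(3)
    by (simp add: matrix_on_kernel[OF basis assms(6,4)] matrix_on_kernel[OF basis assms(7,5)]
        inner_add_left orth)
  then show ?thesis
    by (simp add: eq symmetric_matrix_inner[OF assms(2)] eig)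
qed

text \<open>
  This applies the same derivative once more to the relation of \<open>corrector_component\<close>.  The derivative
  \<open>d\<close> acts on vector fields, \<open>e\<close> on the vectors of kernel components and \<open>r\<close> on scalar fields:
  they are the same operator at three types.
\<close>

lemma corrector_derivative:
  fixes r :: "('a::real_normed_vector \<Rightarrow> real) \<Rightarrow> 'a \<Rightarrow> real"
  assumes d: "derivative_along S v d" and e: "derivative_along S v e"
    and r: "derivative_along S v r"
    and U0: "smooth_on S U0" and U1: "smooth_on S U1"
    and rel: "\<And>z. z \<in> S \<Longrightarrow> a * (U1 z \<bullet> E) = \<gamma> \<bullet> coords F (d U0 z)"
    and z: "z \<in> S"
  shows "a * (d U1 z \<bullet> E) = \<gamma> \<bullet> e (e (\<lambda>z. coords F (U0 z))) z"
proof -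
  have L1: "bounded_linear (\<lambda>u. a * (u \<bullet> E))"
    by (intro bounded_linear_intros)
  have L2: "bounded_linear (\<lambda>w. \<gamma> \<bullet> coords F w)"
    by (rule bounded_linear_inner_right_comp[OF bounded_linear_coords])
  have dU0: "d U0 differentiable_on S"
    by (rule smooth_on_imp_derivative_differentiable_on[OF d U0])
  have "a * (d U1 z \<bullet> E) = r (\<lambda>z. a * (U1 z \<bullet> E)) z"
    by (rule derivative_along_linear_image[OF d r L1 smooth_on_imp_differentiable_on[OF U1] z,
          symmetric])
  also have "\<dots> = r (\<lambda>z. \<gamma> \<bullet> coords F (d U0 z)) z"
    by (rule derivative_along_cong[OF r rel differentiable_on_linear_image[OF L2 dU0] z])
  also have "\<dots> = \<gamma> \<bullet> coords F (d (d U0) z)"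
    by (rule derivative_along_linear_image[OF d r L2 dU0 z])
  finally show ?thesis
    by (simp add: second_derivative_along_linear_image[OF d e bounded_linear_coords U0 z])
qed

section \<open>The diffusion limit\<close>

theorem proposition2p2:
  fixes D :: "(real \<times> real) set"
    and \<sigma> :: real
    and A1 A2 R :: "real^'n^'n"
    and E :: "'n \<Rightarrow> real^'n"
    and \<mu> :: "'n \<Rightarrow> real"
    and \<iota> :: "'p::finite \<Rightarrow> 'n"
    and i1 i2 :: 'n
    and \<gamma>1 \<gamma>2 :: "real^'p"
  assumes "polygonal_domain D"
    and "\<sigma> > 0"
    and "symmetric_matrix A1" and "symmetric_matrix A2" and "symmetric_matrix R"
    and "nonneg_matrix R"
    and "matrix_kernel R \<noteq> {0}"
    and "eigenbasis_with_kernel_part R E \<mu> \<iota>"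
    and "i1 \<noteq> i2" and "independent {E i1, E i2}"
    and "\<mu> i1 > 0" and "\<mu> i2 > 0"
    and "\<forall>i. A1 *v E (\<iota> i) = (\<gamma>1 $ i) *\<^sub>R E i1"
    and "\<forall>i. A2 *v E (\<iota> i) = (\<gamma>2 $ i) *\<^sub>R E i2"
  shows "admits_formal_diffusion_limit D \<sigma> A1 A2 R (\<lambda>i. E (\<iota> i))
           (diffusion_equation D (1 / (\<mu> i1 * \<sigma>)) (tensor \<gamma>1 \<gamma>1) (1 / (\<mu> i2 * \<sigma>)) (tensor \<gamma>2 \<gamma>2))
       \<and> symmetric_matrix (tensor \<gamma>1 \<gamma>1) \<and> nonneg_matrix (tensor \<gamma>1 \<gamma>1)
       \<and> symmetric_matrix (tensor \<gamma>2 \<gamma>2) \<and> nonneg_matrix (tensor \<gamma>2 \<gamma>2)"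
proof (intro conjI symmetric_tensor nonneg_tensor)
  let ?S = "space_time D" and ?F = "\<lambda>i. E (\<iota> i)"
  note basis = assms(8)
  note A1 = assms(13)[rule_format] and A2 = assms(14)[rule_format]
  have "open D"
    using assms(1) by (simp add: polygonal_domain_def)
  note dx = derivative_along_dx[OF this] and dy = derivative_along_dy[OF this]
  show "admits_formal_diffusion_limit D \<sigma> A1 A2 R ?F
          (diffusion_equation D (1 / (\<mu> i1 * \<sigma>)) (tensor \<gamma>1 \<gamma>1) (1 / (\<mu> i2 * \<sigma>)) (tensor \<gamma>2 \<gamma>2))"
    unfolding admits_formal_diffusion_limit_def diffusion_equation_def
      coords_def[where F = ?F, symmetric]
  proof (intro allI impI ballI)
    fix U0 U1 U2 :: "real \<times> real \<times> real \<Rightarrow> real^'n" and z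
    assume U0: "smooth_on ?S U0" and U1: "smooth_on ?S U1"
      and hier: "hilbert_hierarchy D \<sigma> A1 A2 R U0 U1 U2" and z: "z \<in> ?S"
    let ?V = "\<lambda>z. coords ?F (U0 z)"
    have RU0: "R *v U0 z = 0"
      and order1: "A1 *v dx U0 z + A2 *v dy U0 z = - (\<sigma> *\<^sub>R (R *v U1 z))"
      and order0: "dt U0 z + A1 *v dx U1 z + A2 *v dy U1 z = - (\<sigma> *\<^sub>R (R *v U2 z))"
      if "z \<in> ?S" for z
      using hier that by (auto simp: hilbert_hierarchy_def)
    note U0_diff = smooth_on_imp_differentiable_on[OF U0]
    note Rdx = derivative_along_in_matrix_kernel[OF dx U0_diff RU0]
    note Rdy = derivative_along_in_matrix_kernel[OF dy U0_diff RU0]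

    have "(- (\<sigma> * \<mu> i1)) * (U1 z \<bullet> E i1) = \<gamma>1 \<bullet> coords ?F (dx U0 z)" if "z \<in> ?S" for z
      by (rule corrector_component[OF basis assms(5,9) A1 A2 Rdx Rdy order1]) (simp_all add: that)
    then have x: "(- (\<sigma> * \<mu> i1)) * (dx U1 z \<bullet> E i1) = \<gamma>1 \<bullet> dx (dx ?V) z"
      by (rule corrector_derivative[OF dx dx dx U0 U1 _ z])
    have "(- (\<sigma> * \<mu> i2)) * (U1 z \<bullet> E i2) = \<gamma>2 \<bullet> coords ?F (dy U0 z)" if "z \<in> ?S" for z
      by (rule corrector_component[OF basis assms(5) assms(9)[symmetric] A2 A1 Rdy Rdx
            order1[unfolded add.commute[of "A1 *v _"]]]) (simp_all add: that)
    then have y: "(- (\<sigma> * \<mu> i2)) * (dy U1 z \<bullet> E i2) = \<gamma>2 \<bullet> dy (dy ?V) z"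
      by (rule corrector_derivative[OF dy dy dy U0 U1 _ z])

    interpret P: bounded_linear "coords ?F"
      by (rule bounded_linear_coords)
    have RE: "R *v E (\<iota> i) = 0" for i
    proof -
      have "E (\<iota> i) \<in> span (range ?F)"
        by (rule span_base) simp
      then show ?thesis
        using basis by (simp add: eigenbasis_with_kernel_part_def matrix_kernel_def)
    qed
    have "coords ?F (R *v U2 z) = 0"
      by (subst vec_eq_iff) (simp add: coords_def symmetric_matrix_inner[OF assms(5)] RE)
    then have "coords ?F (dt U0 z) + coords ?F (A1 *v dx U1 z) + coords ?F (A2 *v dy U1 z) = 0"
      using arg_cong[OF order0[OF z], of "coords ?F"] by (simp add: P.add P.neg P.scaleR)
    then have order0_kernel:
      "dt ?V z + (dx U1 z \<bullet> E i1) *\<^sub>R \<gamma>1 + (dy U1 z \<bullet> E i2) *\<^sub>R \<gamma>2 = 0"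
      by (simp add: kernel_coords_flux[OF assms(3) A1] kernel_coords_flux[OF assms(4) A2]
          derivative_along_linear_image[OF derivative_along_dt derivative_along_dt
            bounded_linear_coords U0_diff z])
    have "dx U1 z \<bullet> E i1 = - (1 / (\<mu> i1 * \<sigma>)) * (\<gamma>1 \<bullet> dx (dx ?V) z)"
      and "dy U1 z \<bullet> E i2 = - (1 / (\<mu> i2 * \<sigma>)) * (\<gamma>2 \<bullet> dy (dy ?V) z)"
      using x y assms(2,11,12) by (simp_all add: field_simps)
    with order0_kernel
    show "dt ?V z - (1 / (\<mu> i1 * \<sigma>)) *\<^sub>R (tensor \<gamma>1 \<gamma>1 *v dx (dx ?V) z)
            - (1 / (\<mu> i2 * \<sigma>)) *\<^sub>R (tensor \<gamma>2 \<gamma>2 *v dy (dy ?V) z) = 0"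
      by (simp add: tensor_mult_vector)
  qed
qed

end
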